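(* For a dynamical system $(X,T)$ the following statements are equivalent: (i) $(X,T)$ is weakly mixing; (ii) $(\mathcal{M}(X),T)$ is weakly mixing; (iii) $(\mathcal{M}(X),T)$ is transitive.
   Context: A dynamical system $(X,T)$ is a compact metric space $X$ with a continuous surjection $T\colon X\to X$. $\mathcal{M}(X)$ is the set of Borel probability measures on $X$ with the (compact metrizable) weak*-topology, and $T\mu:=T_*\mu$ is the push forward; $(\mathcal{M}(X),T)$ is a dynamical system. $\mathbb{N}$ denotes the positive integers. $(X,T)$ is (topologically) transitive if for all non-empty open $U,V\subseteq X$ there is $k\in\mathbb{N}$ with $T^kU\cap V\ne\emptyset$. $(X,T)$ is (topologically) weakly mixing if $X^2$ with the map $(x,x')\mapsto(Tx,Tx')$ is transitive. *)

theory Defs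
  imports "HOL-Probability.Probability"
begin

definition dynamical_system :: "'a::metric_space set \<Rightarrow> ('a \<Rightarrow> 'a) \<Rightarrow> bool" where
  "dynamical_system X T \<longleftrightarrow> compact X \<and> continuous_on X T \<and> T ` X = X"

text \<open>Transitivity and weak mixing are stated for abstract topologies, so that the same notions
  apply to \<open>X\<close>, to the space of probability measures on \<open>X\<close>, and to their squares.\<close>

definition topologically_transitive :: "'a topology \<Rightarrow> ('a \<Rightarrow> 'a) \<Rightarrow> bool" where
  "topologically_transitive \<tau> T \<longleftrightarrow>
     (\<forall>U V. openin \<tau> U \<and> U \<noteq> {} \<and> openin \<tau> V \<and> V \<noteq> {} \<longrightarrow>
        (\<exists>k::nat. k \<ge> 1 \<and> (T ^^ k) ` U \<inter> V \<noteq> {}))"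

definition weakly_mixing :: "'a topology \<Rightarrow> ('a \<Rightarrow> 'a) \<Rightarrow> bool" where
  "weakly_mixing \<tau> T \<longleftrightarrow> topologically_transitive (prod_topology \<tau> \<tau>) (map_prod T T)"

definition borel_prob_measures :: "'a::metric_space set \<Rightarrow> 'a measure set" where
  "borel_prob_measures X = {\<mu>. sets \<mu> = sets (restrict_space borel X) \<and> prob_space \<mu>}"

text \<open>The coarsest topology for which all maps \<open>\<mu> \<mapsto> \<integral> f d\<mu>\<close> with \<open>f\<close> a continuous real function
  on \<open>X\<close> are continuous.\<close>

definition weak_star_topology :: "'a::metric_space set \<Rightarrow> 'a measure topology" where
  "weak_star_topology X = topology_generated_by
     {{\<mu> \<in> borel_prob_measures X. (\<integral>x. f x \<partial>\<mu>) \<in> W} | (f :: 'a \<Rightarrow> real) (W :: real set).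
        continuous_on X f \<and> open W}"

definition push_forward ::
    "'a::metric_space set \<Rightarrow> ('a \<Rightarrow> 'a) \<Rightarrow> 'a measure \<Rightarrow> 'a measure" where
  "push_forward X T \<mu> = distr \<mu> (restrict_space borel X) T"

lemma topspace_weak_star_topology [simp]:
  "topspace (weak_star_topology X) = borel_prob_measures X"
proof -
  have "borel_prob_measures X \<in>
     {{\<mu> \<in> borel_prob_measures X. (\<integral>x. f x \<partial>\<mu>) \<in> W} | (f :: 'a \<Rightarrow> real) (W :: real set).
        continuous_on X f \<and> open W}"
    by (rule CollectI, intro exI[of _ "\<lambda>_. 0"] exI[of _ UNIV]) auto
  then show ?thesis
    unfolding weak_star_topology_def topology_generated_by_topspace by blast
qed

lemma push_forward_in_borel_prob_measures:
  assumes "dynamical_system X T" and "\<mu> \<in> borel_prob_measures X"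
  shows "push_forward X T \<mu> \<in> borel_prob_measures X"
proof -
  have sets: "sets \<mu> = sets (restrict_space borel X)" and prob: "prob_space \<mu>"
    using assms(2) by (auto simp: borel_prob_measures_def)
  have "T \<in> restrict_space borel X \<rightarrow>\<^sub>M restrict_space borel X"
    using assms(1) unfolding dynamical_system_def
    by (intro measurable_restrict_space2 borel_measurable_continuous_on_restrict)
      (auto simp: space_restrict_space)
  then have "T \<in> \<mu> \<rightarrow>\<^sub>M restrict_space borel X"
    using sets measurable_cong_sets by blast
  then show ?thesis
    using prob by (simp add: borel_prob_measures_def push_forward_def prob_space.prob_space_distr)
qed

end

theory Submission
  imports Defs
begin

text \<open>
  Both transitivity and weak mixing are statements about hitting times
  \<open>N(U, V) = {k \<ge> 1. T\<^sup>k U \<inter> V \<noteq> {}}\<close>: a system is weakly mixing iff any two such sets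
  with non-empty open arguments meet.

  \<^emph>\<open>From the space to the measures.\<close> By Furstenberg's intersection lemma, the sets
  \<open>N(U, V)\<close> of a weakly mixing system form a filter base
  (\<open>hitting_times_filter_base\<close>). Applied to the finitely many pairs of balls around a finite
  net, this gives for every \<open>r > 0\<close> a single time \<open>k\<close> and a measurable \<open>z : X \<times> X \<rightarrow> X\<close> such that
  \<open>z(x, y)\<close> is \<open>r\<close>-close to \<open>x\<close> and \<open>T\<^sup>k z(x, y)\<close> is \<open>r\<close>-close to \<open>y\<close>
  (\<open>weakly_mixing_approximate_transport\<close>). For measures \<open>\<mu>\<close> and \<open>\<nu>\<close>, the image of
  \<open>\<mu> \<otimes> \<nu>\<close> under \<open>z\<close> is then weak-star close to \<open>\<mu>\<close>, because it arises from the first marginal by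
  moving every point less than \<open>r\<close>, and its \<open>k\<close>-th push forward is close to \<open>\<nu>\<close> for the same
  reason (\<open>weak_star_nbhd_small_displacement\<close>). Since \<open>k\<close> does not depend on \<open>\<mu>\<close> and \<open>\<nu>\<close>, it
  serves two pairs of measures at once, which is weak mixing.

  \<^emph>\<open>From the measures to the space.\<close> Given open \<open>U\<close>, \<open>V\<close>, \<open>V'\<close>, transitivity on the measures
  produces a measure \<open>\<mu>\<close> with more than two thirds of its mass in \<open>U\<close> whose image under some
  \<open>T\<^sup>k\<close> gives more than one third to each of \<open>V\<close> and \<open>V'\<close>. As these masses add up to more than 1,
  some points of \<open>U\<close> go to \<open>V\<close> and some go to \<open>V'\<close>, so \<open>N(U, V)\<close> and \<open>N(U, V')\<close> meet
  (\<open>transitive_measures_common_source\<close>). That this special case with a common source \<open>U\<close> already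
  implies weak mixing is \<open>weakly_mixing_if_common_source\<close>.
\<close>

section \<open>Hitting times\<close>

definition hitting_times :: "('a \<Rightarrow> 'a) \<Rightarrow> 'a set \<Rightarrow> 'a set \<Rightarrow> nat set" where
  "hitting_times T U V = {k. k \<ge> 1 \<and> (\<exists>x\<in>U. (T ^^ k) x \<in> V)}"

lemma topologically_transitive_iff_hitting_times:
  "topologically_transitive \<tau> T \<longleftrightarrow>
     (\<forall>U V. openin \<tau> U \<and> U \<noteq> {} \<and> openin \<tau> V \<and> V \<noteq> {} \<longrightarrow> hitting_times T U V \<noteq> {})"
  unfolding topologically_transitive_def hitting_times_def by (auto simp: disjoint_iff)

lemma funpow_map_prod:
  fixes f :: "'a \<Rightarrow> 'a" and g :: "'b \<Rightarrow> 'b"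
  shows "map_prod f g ^^ k = map_prod (f ^^ k) (g ^^ k)"
  by (induction k) (auto simp: fun_eq_iff)

lemma hitting_times_Times:
  "hitting_times (map_prod T S) (U \<times> U') (V \<times> V') = hitting_times T U V \<inter> hitting_times S U' V'"
  unfolding hitting_times_def funpow_map_prod by auto

lemma hitting_times_mono:
  "U \<subseteq> U' \<Longrightarrow> V \<subseteq> V' \<Longrightarrow> hitting_times T U V \<subseteq> hitting_times T U' V'"
  unfolding hitting_times_def by blast

lemma openin_prod_topology_rectangle:
  assumes "openin (prod_topology \<tau> \<sigma>) W" "W \<noteq> {}"
  obtains U V where "openin \<tau> U" "U \<noteq> {}" "openin \<sigma> V" "V \<noteq> {}" "U \<times> V \<subseteq> W"
proof -
  obtain x y where xy: "(x, y) \<in> W" using assms(2) by auto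
  have "\<exists>U V. openin \<tau> U \<and> openin \<sigma> V \<and> x \<in> U \<and> y \<in> V \<and> U \<times> V \<subseteq> W"
    using assms(1) xy unfolding openin_prod_topology_alt by simp
  then show thesis
    using that by blast
qed

lemma weakly_mixing_iff_hitting_times:
  "weakly_mixing \<tau> T \<longleftrightarrow>
     (\<forall>U V U' V'. openin \<tau> U \<and> U \<noteq> {} \<and> openin \<tau> V \<and> V \<noteq> {} \<and>
        openin \<tau> U' \<and> U' \<noteq> {} \<and> openin \<tau> V' \<and> V' \<noteq> {} \<longrightarrow>
        hitting_times T U V \<inter> hitting_times T U' V' \<noteq> {})" (is "_ \<longleftrightarrow> ?R")
proof
  assume wm: "weakly_mixing \<tau> T"
  show ?R
  proof (intro allI impI)
    fix U V U' V'
    assume *: "openin \<tau> U \<and> U \<noteq> {} \<and> openin \<tau> V \<and> V \<noteq> {} \<and>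
        openin \<tau> U' \<and> U' \<noteq> {} \<and> openin \<tau> V' \<and> V' \<noteq> {}"
    then have "openin (prod_topology \<tau> \<tau>) (U \<times> U')" "openin (prod_topology \<tau> \<tau>) (V \<times> V')"
      "U \<times> U' \<noteq> {}" "V \<times> V' \<noteq> {}"
      by (auto simp: openin_prod_Times_iff)
    then show "hitting_times T U V \<inter> hitting_times T U' V' \<noteq> {}"
      using wm unfolding weakly_mixing_def topologically_transitive_iff_hitting_times
        hitting_times_Times[symmetric] by blast
  qed
next
  assume R: ?R
  show "weakly_mixing \<tau> T"
    unfolding weakly_mixing_def topologically_transitive_iff_hitting_times
  proof (intro allI impI)
    fix A B
    assume *: "openin (prod_topology \<tau> \<tau>) A \<and> A \<noteq> {} \<and> openin (prod_topology \<tau> \<tau>) B \<and> B \<noteq> {}"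
    obtain U U' where U: "openin \<tau> U" "U \<noteq> {}" "openin \<tau> U'" "U' \<noteq> {}" "U \<times> U' \<subseteq> A"
      using openin_prod_topology_rectangle * by metis
    obtain V V' where V: "openin \<tau> V" "V \<noteq> {}" "openin \<tau> V'" "V' \<noteq> {}" "V \<times> V' \<subseteq> B"
      using openin_prod_topology_rectangle * by metis
    have "hitting_times (map_prod T T) (U \<times> U') (V \<times> V') \<noteq> {}"
      unfolding hitting_times_Times using R U V by blast
    then show "hitting_times (map_prod T T) A B \<noteq> {}"
      using hitting_times_mono[OF U(5) V(5)] by blast
  qed
qed

lemma weakly_mixing_imp_topologically_transitive:
  "weakly_mixing \<tau> T \<Longrightarrow> topologically_transitive \<tau> T"
  unfolding weakly_mixing_iff_hitting_times topologically_transitive_iff_hitting_times by blast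

lemma continuous_map_funpow: "continuous_map \<tau> \<tau> T \<Longrightarrow> continuous_map \<tau> \<tau> (T ^^ k)"
  by (induction k) (auto intro: continuous_map_compose simp: id_def[symmetric])

lemma funpow_image_eq: "T ` S = S \<Longrightarrow> (T ^^ k) ` S = S"
proof (induction k)
  case (Suc k)
  have "(T ^^ Suc k) ` S = T ` ((T ^^ k) ` S)"
    by (simp add: image_image)
  then show ?case
    using Suc by simp
qed simp

lemma funpow_commute_apply: "(T ^^ k) ((T ^^ m) x) = (T ^^ m) ((T ^^ k) x)"
  by (simp add: add.commute flip: funpow_add[THEN fun_cong, unfolded comp_apply])

text \<open>
  To meet \<open>N(U, V)\<close> and \<open>N(U', V')\<close>, let \<open>n \<in> N(U, U')\<close> and take the common source
  \<open>U \<inter> T\<^sup>-\<^sup>n U'\<close> with targets \<open>V\<close> and \<open>T\<^sup>-\<^sup>n V'\<close>. A point travelling from the source to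
  \<open>T\<^sup>-\<^sup>n V'\<close> in time \<open>m\<close> has its \<open>n\<close>-th image travelling from \<open>U'\<close> to \<open>V'\<close> in time \<open>m\<close>.
  Surjectivity ensures that \<open>T\<^sup>-\<^sup>n V'\<close> is non-empty.
\<close>

lemma weakly_mixing_if_common_source:
  assumes cont: "continuous_map \<tau> \<tau> T" and surj: "T ` topspace \<tau> = topspace \<tau>"
    and common: "\<And>U V V'. \<lbrakk>openin \<tau> U; U \<noteq> {}; openin \<tau> V; V \<noteq> {}; openin \<tau> V'; V' \<noteq> {}\<rbrakk>
      \<Longrightarrow> hitting_times T U V \<inter> hitting_times T U V' \<noteq> {}"
  shows "weakly_mixing \<tau> T"
  unfolding weakly_mixing_iff_hitting_times
proof (intro allI impI, elim conjE)
  fix U V U' V'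
  assume U: "openin \<tau> U" "U \<noteq> {}" and V: "openin \<tau> V" "V \<noteq> {}"
    and U': "openin \<tau> U'" "U' \<noteq> {}" and V': "openin \<tau> V'" "V' \<noteq> {}"
  obtain n where n: "n \<in> hitting_times T U U'"
    using common[OF U U' U'] by blast
  define pre where "pre S = {x \<in> topspace \<tau>. (T ^^ n) x \<in> S}" for S
  have pre: "openin \<tau> (pre S)" if "openin \<tau> S" for S
    unfolding pre_def by (rule openin_continuous_map_preimage[OF continuous_map_funpow[OF cont] that])
  have "V' \<subseteq> (T ^^ n) ` topspace \<tau>"
    using funpow_image_eq[OF surj] openin_subset[OF V'(1)] by simp
  then have V'_pre: "pre V' \<noteq> {}"
    using V'(2) unfolding pre_def by blast
  have "U \<inter> pre U' \<noteq> {}"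
    using n openin_subset[OF U(1)] unfolding hitting_times_def pre_def by blast
  then obtain m where m: "m \<in> hitting_times T (U \<inter> pre U') V" "m \<in> hitting_times T (U \<inter> pre U') (pre V')"
    using common[OF openin_Int[OF U(1) pre[OF U'(1)]] _ V pre[OF V'(1)] V'_pre] by blast
  from m(2) obtain y where "m \<ge> 1" "(T ^^ n) y \<in> U'" "(T ^^ m) ((T ^^ n) y) \<in> V'"
    unfolding hitting_times_def pre_def by (auto simp: funpow_commute_apply[of n T m])
  then have "m \<in> hitting_times T U' V'"
    unfolding hitting_times_def by blast
  moreover have "m \<in> hitting_times T U V"
    using m(1) hitting_times_mono[of "U \<inter> pre U'" U V V T] by blast
  ultimately show "hitting_times T U V \<inter> hitting_times T U' V' \<noteq> {}"
    by blast
qed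

text \<open>
  Furstenberg's intersection lemma. Here \<open>n\<close> is a common element of \<open>N(U, U')\<close> and
  \<open>N(V, V')\<close>; then \<open>A = U \<inter> T\<^sup>-\<^sup>n U'\<close> and \<open>B = V \<inter> T\<^sup>-\<^sup>n V'\<close> are non-empty, and the orbit segment
  of a point going from \<open>A\<close> to \<open>B\<close>, shifted by \<open>n\<close>, goes from \<open>U'\<close> to \<open>V'\<close>.
\<close>

lemma hitting_times_filter_base:
  assumes cont: "continuous_map \<tau> \<tau> T" and wm: "weakly_mixing \<tau> T"
    and U: "openin \<tau> U" "U \<noteq> {}" and V: "openin \<tau> V" "V \<noteq> {}"
    and U': "openin \<tau> U'" "U' \<noteq> {}" and V': "openin \<tau> V'" "V' \<noteq> {}"
  obtains A B where "openin \<tau> A" "A \<noteq> {}" "openin \<tau> B" "B \<noteq> {}"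
    "hitting_times T A B \<subseteq> hitting_times T U V \<inter> hitting_times T U' V'"
proof -
  obtain n where n: "n \<in> hitting_times T U U'" "n \<in> hitting_times T V V'"
    using wm U V U' V' unfolding weakly_mixing_iff_hitting_times by blast
  define pre where "pre S = {x \<in> topspace \<tau>. (T ^^ n) x \<in> S}" for S
  have pre: "openin \<tau> (pre S)" if "openin \<tau> S" for S
    unfolding pre_def by (rule openin_continuous_map_preimage[OF continuous_map_funpow[OF cont] that])
  show thesis
  proof (rule that)
    show "openin \<tau> (U \<inter> pre U')" "openin \<tau> (V \<inter> pre V')"
      using U V pre U' V' by auto
    show "U \<inter> pre U' \<noteq> {}" "V \<inter> pre V' \<noteq> {}"
      using n openin_subset[OF U(1)] openin_subset[OF V(1)]
      unfolding hitting_times_def pre_def by blast+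
    show "hitting_times T (U \<inter> pre U') (V \<inter> pre V') \<subseteq> hitting_times T U V \<inter> hitting_times T U' V'"
      unfolding hitting_times_def pre_def by (auto simp: funpow_commute_apply[of n T])
  qed
qed

lemma weakly_mixing_finite_hitting_times:
  assumes cont: "continuous_map \<tau> \<tau> T" and wm: "weakly_mixing \<tau> T"
    and "finite I"
    and open_U: "\<And>i. i \<in> I \<Longrightarrow> openin \<tau> (U i)" "\<And>i. i \<in> I \<Longrightarrow> U i \<noteq> {}"
    and open_V: "\<And>i. i \<in> I \<Longrightarrow> openin \<tau> (V i)" "\<And>i. i \<in> I \<Longrightarrow> V i \<noteq> {}"
    and ne: "topspace \<tau> \<noteq> {}"
  obtains k where "k \<ge> 1" "\<And>i. i \<in> I \<Longrightarrow> k \<in> hitting_times T (U i) (V i)"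
proof -
  have "\<exists>A B. openin \<tau> A \<and> A \<noteq> {} \<and> openin \<tau> B \<and> B \<noteq> {} \<and>
      (\<forall>i\<in>I. hitting_times T A B \<subseteq> hitting_times T (U i) (V i))"
    using \<open>finite I\<close> open_U open_V
  proof (induction I rule: finite_induct)
    case empty
    then show ?case using ne by blast
  next
    case (insert j J)
    have "\<exists>A B. openin \<tau> A \<and> A \<noteq> {} \<and> openin \<tau> B \<and> B \<noteq> {} \<and>
        (\<forall>i\<in>J. hitting_times T A B \<subseteq> hitting_times T (U i) (V i))"
      using insert.prems by (intro insert.IH) auto
    then obtain A B where AB: "openin \<tau> A" "A \<noteq> {}" "openin \<tau> B" "B \<noteq> {}"
      "\<And>i. i \<in> J \<Longrightarrow> hitting_times T A B \<subseteq> hitting_times T (U i) (V i)"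
      by blast
    obtain A' B' where A'B': "openin \<tau> A'" "A' \<noteq> {}" "openin \<tau> B'" "B' \<noteq> {}"
      "hitting_times T A' B' \<subseteq> hitting_times T A B \<inter> hitting_times T (U j) (V j)"
      by (rule hitting_times_filter_base[OF cont wm AB(1-4), of "U j" "V j"])
        (use insert.prems in auto)
    moreover have "\<forall>i\<in>insert j J. hitting_times T A' B' \<subseteq> hitting_times T (U i) (V i)"
      using A'B'(5) AB(5) by blast
    ultimately show ?case by blast
  qed
  then obtain A B where AB: "openin \<tau> A" "A \<noteq> {}" "openin \<tau> B" "B \<noteq> {}"
    "\<And>i. i \<in> I \<Longrightarrow> hitting_times T A B \<subseteq> hitting_times T (U i) (V i)"
    by blast
  obtain k where "k \<in> hitting_times T A B"
    using weakly_mixing_imp_topologically_transitive[OF wm] AB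
    unfolding topologically_transitive_iff_hitting_times by blast
  then show thesis
    using that AB(5) unfolding hitting_times_def by blast
qed

section \<open>The dynamical system and its induced system\<close>

lemma dynamical_system_continuous_map:
  "dynamical_system X T \<Longrightarrow> continuous_map (top_of_set X) (top_of_set X) T"
  unfolding dynamical_system_def by auto

lemma dynamical_system_measurable:
  assumes "dynamical_system X T"
  shows "T \<in> restrict_space borel X \<rightarrow>\<^sub>M restrict_space borel X"
  using assms unfolding dynamical_system_def
  by (intro measurable_restrict_space2 borel_measurable_continuous_on_restrict)
    (auto simp: space_restrict_space)

lemma measurable_funpow: "T \<in> M \<rightarrow>\<^sub>M M \<Longrightarrow> T ^^ k \<in> M \<rightarrow>\<^sub>M M"
  by (induction k) (auto intro: measurable_comp)

lemma push_forward_funpow_distr: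
  assumes sys: "dynamical_system X T" and b: "b \<in> Q \<rightarrow>\<^sub>M restrict_space borel X"
  shows "(push_forward X T ^^ k) (distr Q (restrict_space borel X) b) =
    distr Q (restrict_space borel X) (\<lambda>w. (T ^^ k) (b w))"
proof (induction k)
  case (Suc k)
  have "(\<lambda>w. (T ^^ k) (b w)) \<in> Q \<rightarrow>\<^sub>M restrict_space borel X"
    using measurable_compose[OF b measurable_funpow[OF dynamical_system_measurable[OF sys]]] .
  then have "push_forward X T (distr Q (restrict_space borel X) (\<lambda>w. (T ^^ k) (b w))) =
      distr Q (restrict_space borel X) (\<lambda>w. T ((T ^^ k) (b w)))"
    using dynamical_system_measurable[OF sys]
    by (simp add: push_forward_def distr_distr comp_def)
  then show ?case
    by (simp add: Suc)
qed simp

lemma distr_in_borel_prob_measures: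
  "prob_space Q \<Longrightarrow> b \<in> Q \<rightarrow>\<^sub>M restrict_space borel X \<Longrightarrow>
    distr Q (restrict_space borel X) b \<in> borel_prob_measures X"
  by (simp add: borel_prob_measures_def prob_space.prob_space_distr)

lemma measurable_funpow_borel_prob_measure:
  assumes "dynamical_system X T" "\<mu> \<in> borel_prob_measures X"
  shows "T ^^ k \<in> \<mu> \<rightarrow>\<^sub>M restrict_space borel X"
  using measurable_funpow[OF dynamical_system_measurable[OF assms(1)], of k] assms(2)
  by (auto simp: borel_prob_measures_def cong: measurable_cong_sets)

lemma borel_prob_measure_distr_id:
  assumes "\<mu> \<in> borel_prob_measures X"
  shows "distr \<mu> (restrict_space borel X) (\<lambda>x. x) = \<mu>"
  using assms by (intro distr_id2) (auto simp: borel_prob_measures_def)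

lemma push_forward_funpow:
  assumes sys: "dynamical_system X T" and \<mu>: "\<mu> \<in> borel_prob_measures X"
  shows "(push_forward X T ^^ k) \<mu> = distr \<mu> (restrict_space borel X) (T ^^ k)"
proof -
  have "(\<lambda>x. x) \<in> \<mu> \<rightarrow>\<^sub>M restrict_space borel X"
    using measurable_funpow_borel_prob_measure[OF sys \<mu>, of 0] by (simp add: id_def)
  from push_forward_funpow_distr[OF sys this, of k] show ?thesis
    unfolding borel_prob_measure_distr_id[OF \<mu>] .
qed

section \<open>Weak-star neighbourhoods\<close>

lemma integrable_continuous_bounded_measurable:
  fixes f :: "'a::metric_space \<Rightarrow> real"
  assumes Q: "prob_space Q" and b: "b \<in> Q \<rightarrow>\<^sub>M restrict_space borel X"
    and X: "compact X" and f: "continuous_on X f"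
  shows "integrable Q (\<lambda>w. f (b w))"
proof -
  interpret prob_space Q by fact
  have meas: "(\<lambda>w. f (b w)) \<in> borel_measurable Q"
    by (rule measurable_compose[OF b borel_measurable_continuous_on_restrict[OF f]])
  obtain B where B: "\<And>x. x \<in> X \<Longrightarrow> norm (f x) \<le> B"
    using compact_imp_bounded[OF compact_continuous_image[OF f X]] unfolding bounded_iff by auto
  have "b w \<in> X" if "w \<in> space Q" for w
    using measurable_space[OF b that] by (simp add: space_restrict_space)
  then show ?thesis
    by (intro integrable_const_bound[OF _ meas, of B] AE_I2 B)
qed

text \<open>
  For a single test function this is uniform continuity: moving all points by less than
  \<open>\<delta>\<close> changes the integral by little. Finite intersections and unions preserve the property, so
  it passes from the generating sets to all open sets by induction. Stated for couplings
  \<open>(a, b)\<close> rather than for transport maps, it applies to both marginals of a product measure.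
\<close>

lemma weak_star_nbhd_small_displacement:
  fixes X :: "'a::metric_space set"
  assumes X: "compact X" and U: "openin (weak_star_topology X) U" and \<mu>: "\<mu> \<in> U"
  obtains \<delta> where "\<delta> > 0"
    "\<And>(Q :: 'b measure) a b. \<lbrakk>prob_space Q; a \<in> Q \<rightarrow>\<^sub>M restrict_space borel X;
      b \<in> Q \<rightarrow>\<^sub>M restrict_space borel X; distr Q (restrict_space borel X) a = \<mu>;
      \<And>w. w \<in> space Q \<Longrightarrow> dist (a w) (b w) < \<delta>\<rbrakk>
      \<Longrightarrow> distr Q (restrict_space borel X) b \<in> U"
proof -
  define good where "good \<delta> U \<longleftrightarrow>
     (\<forall>(Q :: 'b measure) a b. prob_space Q \<longrightarrow> a \<in> Q \<rightarrow>\<^sub>M restrict_space borel X \<longrightarrow>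
      b \<in> Q \<rightarrow>\<^sub>M restrict_space borel X \<longrightarrow> distr Q (restrict_space borel X) a = \<mu> \<longrightarrow>
      (\<forall>w\<in>space Q. dist (a w) (b w) < \<delta>)
      \<longrightarrow> distr Q (restrict_space borel X) b \<in> U)" for \<delta> :: real and U
  have good_mono: "good \<delta>' V" if "good \<delta> U" "\<delta>' \<le> \<delta>" "U \<subseteq> V" for \<delta> \<delta>' U V
    unfolding good_def
  proof (intro allI impI)
    fix Q :: "'b measure" and a b
    assume *: "prob_space Q" "a \<in> Q \<rightarrow>\<^sub>M restrict_space borel X"
      "b \<in> Q \<rightarrow>\<^sub>M restrict_space borel X" "distr Q (restrict_space borel X) a = \<mu>"
      and "\<forall>w\<in>space Q. dist (a w) (b w) < \<delta>'"
    then have "\<forall>w\<in>space Q. dist (a w) (b w) < \<delta>"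
      using \<open>\<delta>' \<le> \<delta>\<close> by fastforce
    then show "distr Q (restrict_space borel X) b \<in> V"
      using \<open>good \<delta> U\<close> \<open>U \<subseteq> V\<close> * unfolding good_def by blast
  qed
  have "\<exists>\<delta>>0. good \<delta> U"
    using U[unfolded weak_star_topology_def openin_topology_generated_by_iff] \<mu>
  proof (induction rule: generate_topology_on.induct)
    case Empty
    then show ?case by simp
  next
    case (Int A B)
    then obtain \<delta> \<delta>' where "\<delta> > 0" "good \<delta> A" "\<delta>' > 0" "good \<delta>' B" by auto
    then have "good (min \<delta> \<delta>') A" "good (min \<delta> \<delta>') B"
      using good_mono by (meson min.cobounded1 min.cobounded2 order_refl)+
    then have "good (min \<delta> \<delta>') (A \<inter> B)"
      unfolding good_def by blast
    then show ?case
      using \<open>\<delta> > 0\<close> \<open>\<delta>' > 0\<close> by (metis min_less_iff_conj)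
  next
    case (UN K)
    then obtain A where "A \<in> K" "\<mu> \<in> A" by blast
    then obtain \<delta> where "\<delta> > 0" "good \<delta> A" using UN.IH by blast
    then show ?case
      using good_mono[OF _ order_refl Union_upper[OF \<open>A \<in> K\<close>]] by blast
  next
    case (Basis S)
    then obtain f :: "'a \<Rightarrow> real" and W where S: "S = {\<mu> \<in> borel_prob_measures X. (\<integral>x. f x \<partial>\<mu>) \<in> W}"
      and f: "continuous_on X f" and W: "open W"
      by blast
    have "(\<integral>x. f x \<partial>\<mu>) \<in> W" using Basis.prems unfolding S by simp
    then obtain \<epsilon> where \<epsilon>: "\<epsilon> > 0" "ball (\<integral>x. f x \<partial>\<mu>) \<epsilon> \<subseteq> W"
      using openE[OF W] by metis
    obtain \<delta> where \<delta>: "\<delta> > 0"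
      "\<And>x y. x \<in> X \<Longrightarrow> y \<in> X \<Longrightarrow> dist x y < \<delta> \<Longrightarrow> dist (f x) (f y) < \<epsilon> / 2"
      using compact_uniformly_continuous[OF f X] \<epsilon>(1)
      unfolding uniformly_continuous_on_def by (metis dist_commute half_gt_zero)
    have "good \<delta> S"
      unfolding good_def
    proof (intro allI impI)
      fix Q :: "'b measure" and a b
      assume Q: "prob_space Q" and a: "a \<in> Q \<rightarrow>\<^sub>M restrict_space borel X"
        and b: "b \<in> Q \<rightarrow>\<^sub>M restrict_space borel X" and \<mu>_eq: "distr Q (restrict_space borel X) a = \<mu>"
        and close: "\<forall>w\<in>space Q. dist (a w) (b w) < \<delta>"
      interpret prob_space Q by fact
      note f_meas = borel_measurable_continuous_on_restrict[OF f]
      have ab: "a w \<in> X" "b w \<in> X" if "w \<in> space Q" for w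
        using measurable_space[OF a that] measurable_space[OF b that]
        by (simp_all add: space_restrict_space)
      have int_a: "integrable Q (\<lambda>w. f (a w))" and int_b: "integrable Q (\<lambda>w. f (b w))"
        using integrable_continuous_bounded_measurable[OF Q _ X f] a b by auto
      have "\<bar>(\<integral>w. f (a w) \<partial>Q) - (\<integral>w. f (b w) \<partial>Q)\<bar> = \<bar>\<integral>w. f (a w) - f (b w) \<partial>Q\<bar>"
        using int_a int_b by simp
      also have "\<dots> \<le> (\<integral>w. \<bar>f (a w) - f (b w)\<bar> \<partial>Q)"
        by (rule integral_abs_bound)
      also have "\<dots> \<le> (\<integral>w. \<epsilon> / 2 \<partial>Q)"
        using int_a int_b \<delta>(2)[OF ab] close
        by (intro integral_mono) (auto simp: dist_real_def intro!: less_imp_le)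
      also have "\<dots> < \<epsilon>"
        using \<epsilon>(1) by (simp add: prob_space)
      finally have "dist (\<integral>x. f x \<partial>\<mu>) (\<integral>x. f x \<partial>distr Q (restrict_space borel X) b) < \<epsilon>"
        unfolding \<mu>_eq[symmetric] by (simp add: integral_distr[OF a f_meas] integral_distr[OF b f_meas] dist_real_def)
      then show "distr Q (restrict_space borel X) b \<in> S"
        using distr_in_borel_prob_measures[OF Q b] \<epsilon>(2) unfolding S by auto
    qed
    then show ?case using \<delta>(1) by blast
  qed
  then obtain \<delta> where "\<delta> > 0" "good \<delta> U" by blast
  then show thesis
    by (intro that[of \<delta>]) (auto simp: good_def)
qed

section \<open>Weak mixing passes to the measures\<close>

text \<open>
  A point may lie in many balls of a finite cover; the least index is a measurable choice.
\<close>

lemma compact_measurable_net_index: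
  fixes X :: "'a::metric_space set"
  assumes X: "compact X" and r: "r > 0"
  obtains n :: nat and p s where "\<And>i. i < n \<Longrightarrow> p i \<in> X"
    "s \<in> restrict_space borel X \<rightarrow>\<^sub>M count_space UNIV"
    "\<And>x. x \<in> X \<Longrightarrow> s x < n \<and> dist (p (s x)) x < r"
proof -
  obtain P where P: "finite P" "P \<subseteq> X" "X \<subseteq> (\<Union>x\<in>P. ball x r)"
    using compactE_image[OF X, of X "\<lambda>x. ball x r"] r by force
  obtain p and n :: nat where p: "P = p ` {..<n}"
    using finite_imp_nat_seg_image_inj_on[OF P(1)] by (auto simp: lessThan_def)
  define s where "s x = (LEAST i. i < n \<and> dist (p i) x < r)" for x
  show thesis
  proof (rule that)
    show "p i \<in> X" if "i < n" for i
      using that p P(2) by blast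
    have "Measurable.pred (restrict_space borel X) (\<lambda>x. dist (p i) x < r)" for i
    proof -
      have "(\<lambda>x. dist (p i) x) \<in> borel_measurable (restrict_space borel X)"
        by (intro borel_measurable_continuous_on_restrict continuous_intros)
      then show ?thesis by measurable
    qed
    then show "s \<in> restrict_space borel X \<rightarrow>\<^sub>M count_space UNIV"
      unfolding s_def by (intro measurable_Least pred_intros_logic) auto
    show "s x < n \<and> dist (p (s x)) x < r" if x: "x \<in> X" for x
    proof -
      obtain i where "i < n \<and> dist (p i) x < r"
        using P(3) x unfolding p by auto
      then show ?thesis
        unfolding s_def by (rule LeastI)
    qed
  qed
qed

text \<open>
  The map \<open>z\<close> depends on its arguments only through their indices in a finite net, so that
  it is measurable and finitely many conditions on \<open>k\<close> are enough.
\<close>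

lemma weakly_mixing_approximate_transport:
  fixes X :: "'a::metric_space set"
  assumes sys: "dynamical_system X T" and wm: "weakly_mixing (top_of_set X) T"
    and ne: "X \<noteq> {}" and r: "r > 0"
  obtains k z where "k \<ge> 1"
    "z \<in> restrict_space borel X \<Otimes>\<^sub>M restrict_space borel X \<rightarrow>\<^sub>M restrict_space borel X"
    "\<And>x y. x \<in> X \<Longrightarrow> y \<in> X \<Longrightarrow> dist x (z (x, y)) < r"
    "\<And>x y. x \<in> X \<Longrightarrow> y \<in> X \<Longrightarrow> dist y ((T ^^ k) (z (x, y))) < r"
proof -
  have X: "compact X" using sys by (simp add: dynamical_system_def)
  obtain n :: nat and p s where p: "\<And>i. i < n \<Longrightarrow> p i \<in> X"
    and s: "s \<in> restrict_space borel X \<rightarrow>\<^sub>M count_space UNIV"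
    and near: "\<And>x. x \<in> X \<Longrightarrow> s x < n \<and> dist (p (s x)) x < r / 2"
    using compact_measurable_net_index[OF X, of "r / 2"] r by auto
  obtain k where k: "k \<ge> 1" "\<And>ij. ij \<in> {..<n} \<times> {..<n} \<Longrightarrow>
      k \<in> hitting_times T (X \<inter> ball (p (fst ij)) (r / 2)) (X \<inter> ball (p (snd ij)) (r / 2))"
  proof (rule weakly_mixing_finite_hitting_times[OF dynamical_system_continuous_map[OF sys] wm,
        of "{..<n} \<times> {..<n}" "\<lambda>ij. X \<inter> ball (p (fst ij)) (r / 2)" "\<lambda>ij. X \<inter> ball (p (snd ij)) (r / 2)"])
    fix ij assume "ij \<in> {..<n} \<times> {..<n}"
    then have "p (fst ij) \<in> X \<inter> ball (p (fst ij)) (r / 2)" "p (snd ij) \<in> X \<inter> ball (p (snd ij)) (r / 2)"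
      using p r by auto
    then show "X \<inter> ball (p (fst ij)) (r / 2) \<noteq> {}" "X \<inter> ball (p (snd ij)) (r / 2) \<noteq> {}"
      by blast+
  qed (use ne that in auto)
  \<comment> \<open>Index pairs outside the net need a value in \<open>X\<close> too, for \<open>\<zeta>\<close> to be measurable into \<open>X\<close>.\<close>
  have "\<exists>x. x \<in> X \<and> (ij \<in> {..<n} \<times> {..<n} \<longrightarrow>
      dist (p (fst ij)) x < r / 2 \<and> dist (p (snd ij)) ((T ^^ k) x) < r / 2)" for ij
    using k(2)[of ij] ne unfolding hitting_times_def by fastforce
  then obtain \<zeta> where \<zeta>: "\<And>ij. \<zeta> ij \<in> X"
    "\<And>ij. ij \<in> {..<n} \<times> {..<n} \<Longrightarrow> dist (p (fst ij)) (\<zeta> ij) < r / 2"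
    "\<And>ij. ij \<in> {..<n} \<times> {..<n} \<Longrightarrow> dist (p (snd ij)) ((T ^^ k) (\<zeta> ij)) < r / 2"
    by metis
  define z where "z w = \<zeta> (s (fst w), s (snd w))" for w
  show thesis
  proof (rule that[OF k(1)])
    have "(\<lambda>w. (s (fst w), s (snd w))) \<in>
        restrict_space borel X \<Otimes>\<^sub>M restrict_space borel X \<rightarrow>\<^sub>M count_space UNIV \<Otimes>\<^sub>M count_space UNIV"
      using s by measurable
    moreover have "count_space UNIV \<Otimes>\<^sub>M count_space UNIV = (count_space UNIV :: (nat \<times> nat) measure)"
      by (subst pair_measure_countable) auto
    moreover have "\<zeta> \<in> count_space UNIV \<rightarrow>\<^sub>M restrict_space borel X"
      using \<zeta>(1) by (simp add: space_restrict_space)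
    ultimately show "z \<in> restrict_space borel X \<Otimes>\<^sub>M restrict_space borel X \<rightarrow>\<^sub>M restrict_space borel X"
      unfolding z_def by (metis measurable_compose)
    fix x y assume xy: "x \<in> X" "y \<in> X"
    then have idx: "(s x, s y) \<in> {..<n} \<times> {..<n}"
      using near by auto
    show "dist x (z (x, y)) < r"
      using dist_triangle_half_r[of "p (s x)" x r "z (x, y)"] near[OF xy(1)] \<zeta>(2)[OF idx]
      by (simp add: z_def)
    show "dist y ((T ^^ k) (z (x, y))) < r"
      using dist_triangle_half_r[of "p (s y)" y r "(T ^^ k) (z (x, y))"] near[OF xy(2)] \<zeta>(3)[OF idx]
      by (simp add: z_def)
  qed
qed

lemma distr_pair_prob_snd:
  assumes "prob_space M" "sigma_finite_measure N"
  shows "distr (M \<Otimes>\<^sub>M N) N snd = N"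
proof -
  interpret N: sigma_finite_measure N by fact
  interpret M: prob_space M by fact
  show ?thesis
  proof (rule measure_eqI)
    fix A assume A: "A \<in> sets (distr (M \<Otimes>\<^sub>M N) N snd)"
    then have "snd -` A \<inter> space (M \<Otimes>\<^sub>M N) = space M \<times> A"
      by (auto simp: space_pair_measure dest: sets.sets_into_space)
    then show "emeasure (distr (M \<Otimes>\<^sub>M N) N snd) A = emeasure N A"
      using A by (simp add: emeasure_distr N.emeasure_pair_measure_Times M.emeasure_space_1)
  qed simp
qed

lemma weakly_mixing_imp_weakly_mixing_measures:
  fixes X :: "'a::metric_space set"
  assumes sys: "dynamical_system X T" and wm: "weakly_mixing (top_of_set X) T"
  shows "weakly_mixing (weak_star_topology X) (push_forward X T)"
  unfolding weakly_mixing_iff_hitting_times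
proof (intro allI impI, elim conjE)
  let ?B = "restrict_space borel X"
  let ?\<tau> = "weak_star_topology X"
  fix U V U' V'
  assume U: "openin ?\<tau> U" "U \<noteq> {}" and V: "openin ?\<tau> V" "V \<noteq> {}"
    and U': "openin ?\<tau> U'" "U' \<noteq> {}" and V': "openin ?\<tau> V'" "V' \<noteq> {}"
  have X: "compact X" using sys by (simp add: dynamical_system_def)
  obtain \<mu> \<nu> \<mu>' \<nu>' where mem: "\<mu> \<in> U" "\<nu> \<in> V" "\<mu>' \<in> U'" "\<nu>' \<in> V'"
    using U V U' V' by blast
  have prob: "\<mu> \<in> borel_prob_measures X" "\<nu> \<in> borel_prob_measures X"
    "\<mu>' \<in> borel_prob_measures X" "\<nu>' \<in> borel_prob_measures X"
    using mem openin_subset[OF U(1)] openin_subset[OF V(1)] openin_subset[OF U'(1)]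
      openin_subset[OF V'(1)] by auto
  have ne: "X \<noteq> {}"
  proof -
    have "space \<mu> = X"
      using prob(1) sets_eq_imp_space_eq[of \<mu> ?B] by (simp add: borel_prob_measures_def space_restrict_space)
    then show ?thesis
      using prob(1) prob_space.not_empty by (auto simp: borel_prob_measures_def)
  qed
  obtain d1 where d1: "d1 > 0"
    "\<And>(Q :: ('a \<times> 'a) measure) a b. \<lbrakk>prob_space Q; a \<in> Q \<rightarrow>\<^sub>M ?B; b \<in> Q \<rightarrow>\<^sub>M ?B; distr Q ?B a = \<mu>;
      \<And>w. w \<in> space Q \<Longrightarrow> dist (a w) (b w) < d1\<rbrakk> \<Longrightarrow> distr Q ?B b \<in> U"
    using weak_star_nbhd_small_displacement[OF X U(1) mem(1)] by metis
  obtain d2 where d2: "d2 > 0"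
    "\<And>(Q :: ('a \<times> 'a) measure) a b. \<lbrakk>prob_space Q; a \<in> Q \<rightarrow>\<^sub>M ?B; b \<in> Q \<rightarrow>\<^sub>M ?B; distr Q ?B a = \<nu>;
      \<And>w. w \<in> space Q \<Longrightarrow> dist (a w) (b w) < d2\<rbrakk> \<Longrightarrow> distr Q ?B b \<in> V"
    using weak_star_nbhd_small_displacement[OF X V(1) mem(2)] by metis
  obtain d3 where d3: "d3 > 0"
    "\<And>(Q :: ('a \<times> 'a) measure) a b. \<lbrakk>prob_space Q; a \<in> Q \<rightarrow>\<^sub>M ?B; b \<in> Q \<rightarrow>\<^sub>M ?B; distr Q ?B a = \<mu>';
      \<And>w. w \<in> space Q \<Longrightarrow> dist (a w) (b w) < d3\<rbrakk> \<Longrightarrow> distr Q ?B b \<in> U'"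
    using weak_star_nbhd_small_displacement[OF X U'(1) mem(3)] by metis
  obtain d4 where d4: "d4 > 0"
    "\<And>(Q :: ('a \<times> 'a) measure) a b. \<lbrakk>prob_space Q; a \<in> Q \<rightarrow>\<^sub>M ?B; b \<in> Q \<rightarrow>\<^sub>M ?B; distr Q ?B a = \<nu>';
      \<And>w. w \<in> space Q \<Longrightarrow> dist (a w) (b w) < d4\<rbrakk> \<Longrightarrow> distr Q ?B b \<in> V'"
    using weak_star_nbhd_small_displacement[OF X V'(1) mem(4)] by metis
  \<comment> \<open>One radius for all four neighbourhoods, so that the same time serves both pairs.\<close>
  define r where "r = min (min d1 d2) (min d3 d4)"
  have r: "r > 0" "r \<le> d1" "r \<le> d2" "r \<le> d3" "r \<le> d4"
    using d1(1) d2(1) d3(1) d4(1) by (auto simp: r_def)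
  obtain k z where k: "k \<ge> 1" and z: "z \<in> ?B \<Otimes>\<^sub>M ?B \<rightarrow>\<^sub>M ?B"
    and z1: "\<And>x y. x \<in> X \<Longrightarrow> y \<in> X \<Longrightarrow> dist x (z (x, y)) < r"
    and z2: "\<And>x y. x \<in> X \<Longrightarrow> y \<in> X \<Longrightarrow> dist y ((T ^^ k) (z (x, y))) < r"
    using weakly_mixing_approximate_transport[OF sys wm ne r(1)] by blast
  have transport: "k \<in> hitting_times (push_forward X T) A B"
    if \<alpha>: "\<alpha> \<in> borel_prob_measures X" and \<beta>: "\<beta> \<in> borel_prob_measures X"
      and A: "\<And>(Q :: ('a \<times> 'a) measure) a b. \<lbrakk>prob_space Q; a \<in> Q \<rightarrow>\<^sub>M ?B; b \<in> Q \<rightarrow>\<^sub>M ?B;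
        distr Q ?B a = \<alpha>; \<And>w. w \<in> space Q \<Longrightarrow> dist (a w) (b w) < r\<rbrakk> \<Longrightarrow> distr Q ?B b \<in> A"
      and B: "\<And>(Q :: ('a \<times> 'a) measure) a b. \<lbrakk>prob_space Q; a \<in> Q \<rightarrow>\<^sub>M ?B; b \<in> Q \<rightarrow>\<^sub>M ?B;
        distr Q ?B a = \<beta>; \<And>w. w \<in> space Q \<Longrightarrow> dist (a w) (b w) < r\<rbrakk> \<Longrightarrow> distr Q ?B b \<in> B"
    for \<alpha> \<beta> A B
  proof -
    have [measurable_cong]: "sets \<alpha> = sets ?B" "sets \<beta> = sets ?B"
      and ps: "prob_space \<alpha>" "prob_space \<beta>"
      using \<alpha> \<beta> by (auto simp: borel_prob_measures_def)
    interpret pair_prob_space \<alpha> \<beta>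
      using ps by (simp add: pair_prob_space_def pair_sigma_finite_def prob_space_imp_sigma_finite)
    have space_eq: "space \<alpha> = X" "space \<beta> = X"
      using sets_eq_imp_space_eq[of \<alpha> ?B] sets_eq_imp_space_eq[of \<beta> ?B] \<alpha> \<beta>
      by (simp_all add: borel_prob_measures_def space_restrict_space)
    have z': "z \<in> \<alpha> \<Otimes>\<^sub>M \<beta> \<rightarrow>\<^sub>M ?B"
      using z by measurable
    have Tz: "(\<lambda>w. (T ^^ k) (z w)) \<in> \<alpha> \<Otimes>\<^sub>M \<beta> \<rightarrow>\<^sub>M ?B"
      by (rule measurable_compose[OF z' measurable_funpow[OF dynamical_system_measurable[OF sys]]])
    have fst: "distr (\<alpha> \<Otimes>\<^sub>M \<beta>) ?B fst = \<alpha>" and snd: "distr (\<alpha> \<Otimes>\<^sub>M \<beta>) ?B snd = \<beta>"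
      using prob_space.distr_pair_fst[OF ps(2), of \<alpha>] distr_pair_prob_snd[OF ps(1) prob_space_imp_sigma_finite[OF ps(2)]] \<alpha> \<beta>
        distr_cong[of "\<alpha> \<Otimes>\<^sub>M \<beta>" "\<alpha> \<Otimes>\<^sub>M \<beta>" ?B \<alpha> fst fst] distr_cong[of "\<alpha> \<Otimes>\<^sub>M \<beta>" "\<alpha> \<Otimes>\<^sub>M \<beta>" ?B \<beta> snd snd]
      by (auto simp: borel_prob_measures_def)
    have "distr (\<alpha> \<Otimes>\<^sub>M \<beta>) ?B z \<in> A"
      by (rule A[OF prob_space_axioms _ z' fst]) (auto simp: space_pair_measure space_eq z1)
    moreover have "(push_forward X T ^^ k) (distr (\<alpha> \<Otimes>\<^sub>M \<beta>) ?B z) \<in> B"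
      unfolding push_forward_funpow_distr[OF sys z']
      by (rule B[OF prob_space_axioms _ Tz snd]) (auto simp: space_pair_measure space_eq z2)
    ultimately show ?thesis
      using k unfolding hitting_times_def by blast
  qed
  have "k \<in> hitting_times (push_forward X T) U V"
    by (rule transport[OF prob(1,2)]; erule (3) d1(2) d2(2); metis r order_less_le_trans)
  moreover have "k \<in> hitting_times (push_forward X T) U' V'"
    by (rule transport[OF prob(3,4)]; erule (3) d3(2) d4(2); metis r order_less_le_trans)
  ultimately show "hitting_times (push_forward X T) U V \<inter> hitting_times (push_forward X T) U' V' \<noteq> {}"
    by blast
qed

section \<open>Transitivity on the measures forces weak mixing\<close>

lemma openin_top_of_set_bump:
  fixes X :: "'a::metric_space set"
  assumes "openin (top_of_set X) U" "U \<noteq> {}"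
  obtains f :: "'a \<Rightarrow> real" and p where "continuous_on X f" "p \<in> X" "f p = 1"
    "\<And>x. 0 \<le> f x" "\<And>x. f x \<le> 1" "\<And>x. x \<in> X \<Longrightarrow> f x > 0 \<Longrightarrow> x \<in> U"
proof -
  obtain p where p: "p \<in> U" using assms(2) by blast
  obtain r where r: "r > 0" "ball p r \<inter> X \<subseteq> U"
    using assms(1) p unfolding openin_contains_ball by blast
  show thesis
  proof (rule that[of "\<lambda>x. max 0 (1 - dist p x / r)" p])
    show "continuous_on X (\<lambda>x. max 0 (1 - dist p x / r))"
      using r(1) by (intro continuous_intros) auto
    show "p \<in> X"
      using p openin_subset[OF assms(1)] by auto
    fix x assume "x \<in> X" "max 0 (1 - dist p x / r) > 0"
    then show "x \<in> U"
      using r by (auto simp: field_simps less_max_iff_disj)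
  qed (use r in auto)
qed

lemma openin_weak_star_integral_greater:
  assumes "continuous_on X f"
  shows "openin (weak_star_topology X) {\<mu> \<in> borel_prob_measures X. (\<integral>x. f x \<partial>\<mu>) > (c::real)}"
proof -
  have "{\<mu> \<in> borel_prob_measures X. (\<integral>x. f x \<partial>\<mu>) > c} =
      {\<mu> \<in> borel_prob_measures X. (\<integral>x. f x \<partial>\<mu>) \<in> {c<..}}"
    by simp
  then show ?thesis
    unfolding weak_star_topology_def
    by (intro topology_generated_by_Basis CollectI exI conjI) (use assms in auto)
qed

lemma two_point_measure:
  fixes X :: "'a::metric_space set"
  assumes "p \<in> X" "q \<in> X"
  obtains \<mu> where "\<mu> \<in> borel_prob_measures X"
    "\<And>f :: 'a \<Rightarrow> real. continuous_on X f \<Longrightarrow> (\<integral>x. f x \<partial>\<mu>) = (f p + f q) / 2"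
proof -
  let ?b = "\<lambda>c. if c then p else q"
  let ?Q = "measure_pmf (bernoulli_pmf (1 / 2))"
  have b: "?b \<in> ?Q \<rightarrow>\<^sub>M restrict_space borel X"
    using assms by (auto simp: space_restrict_space)
  show thesis
  proof (rule that)
    show "distr ?Q (restrict_space borel X) ?b \<in> borel_prob_measures X"
      by (rule distr_in_borel_prob_measures[OF prob_space_measure_pmf b])
    fix f :: "'a \<Rightarrow> real" assume f: "continuous_on X f"
    show "(\<integral>x. f x \<partial>distr ?Q (restrict_space borel X) ?b) = (f p + f q) / 2"
      by (simp add: integral_distr[OF b borel_measurable_continuous_on_restrict[OF f]])
  qed
qed

text \<open>
  Indicators of \<open>U\<close>, \<open>V\<close>, \<open>V'\<close> are replaced by continuous bump functions \<open>f\<close>, \<open>g\<close>, \<open>g'\<close>,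
  whose integrals define weak-star open sets \<open>A\<close> and \<open>B\<close>. A Dirac measure lies in \<open>A\<close>, and the mean
  of two Dirac measures lies in \<open>B\<close>.
\<close>

lemma transitive_measures_common_source:
  fixes X :: "'a::metric_space set"
  assumes sys: "dynamical_system X T"
    and trans: "topologically_transitive (weak_star_topology X) (push_forward X T)"
    and U: "openin (top_of_set X) U" "U \<noteq> {}" and V: "openin (top_of_set X) V" "V \<noteq> {}"
    and V': "openin (top_of_set X) V'" "V' \<noteq> {}"
  shows "hitting_times T U V \<inter> hitting_times T U V' \<noteq> {}"
proof -
  have X: "compact X" using sys by (simp add: dynamical_system_def)
  obtain f :: "'a \<Rightarrow> real" and p where f: "continuous_on X f" "p \<in> X" "f p = 1"
    "\<And>x. 0 \<le> f x" "\<And>x. f x \<le> 1" "\<And>x. x \<in> X \<Longrightarrow> f x > 0 \<Longrightarrow> x \<in> U"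
    using openin_top_of_set_bump[OF U] by metis
  obtain g :: "'a \<Rightarrow> real" and q where g: "continuous_on X g" "q \<in> X" "g q = 1"
    "\<And>x. 0 \<le> g x" "\<And>x. g x \<le> 1" "\<And>x. x \<in> X \<Longrightarrow> g x > 0 \<Longrightarrow> x \<in> V"
    using openin_top_of_set_bump[OF V] by metis
  obtain g' :: "'a \<Rightarrow> real" and q' where g': "continuous_on X g'" "q' \<in> X" "g' q' = 1"
    "\<And>x. 0 \<le> g' x" "\<And>x. g' x \<le> 1" "\<And>x. x \<in> X \<Longrightarrow> g' x > 0 \<Longrightarrow> x \<in> V'"
    using openin_top_of_set_bump[OF V'] by metis
  define A where "A = {\<mu> \<in> borel_prob_measures X. (\<integral>x. f x \<partial>\<mu>) > 2 / 3}"
  define B where "B = {\<mu> \<in> borel_prob_measures X. (\<integral>x. g x \<partial>\<mu>) > 1 / 3} \<inter>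
    {\<mu> \<in> borel_prob_measures X. (\<integral>x. g' x \<partial>\<mu>) > 1 / 3}"
  have "openin (weak_star_topology X) A" "openin (weak_star_topology X) B"
    unfolding A_def B_def using f(1) g(1) g'(1)
    by (blast intro: openin_weak_star_integral_greater openin_Int)+
  moreover have "A \<noteq> {}"
  proof -
    obtain \<mu> where \<mu>: "\<mu> \<in> borel_prob_measures X"
      "\<And>h :: 'a \<Rightarrow> real. continuous_on X h \<Longrightarrow> (\<integral>x. h x \<partial>\<mu>) = (h p + h p) / 2"
      using two_point_measure[OF f(2) f(2)] by metis
    then have "\<mu> \<in> A" using f unfolding A_def by simp
    then show ?thesis by blast
  qed
  moreover have "B \<noteq> {}"
  proof -
    obtain \<mu> where \<mu>: "\<mu> \<in> borel_prob_measures X"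
      "\<And>h :: 'a \<Rightarrow> real. continuous_on X h \<Longrightarrow> (\<integral>x. h x \<partial>\<mu>) = (h q + h q') / 2"
      using two_point_measure[OF g(2) g'(2)] by metis
    have "(\<integral>x. g x \<partial>\<mu>) = (1 + g q') / 2" "(\<integral>x. g' x \<partial>\<mu>) = (g' q + 1) / 2"
      using \<mu>(2)[OF g(1)] \<mu>(2)[OF g'(1)] g(3) g'(3) by simp_all
    then have "(\<integral>x. g x \<partial>\<mu>) > 1 / 3" "(\<integral>x. g' x \<partial>\<mu>) > 1 / 3"
      using g(4)[of q'] g'(4)[of q] by simp_all
    then have "\<mu> \<in> B"
      using \<mu>(1) unfolding B_def by blast
    then show ?thesis by blast
  qed
  ultimately obtain k where "k \<in> hitting_times (push_forward X T) A B"
    using trans unfolding topologically_transitive_iff_hitting_times by blast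
  then obtain \<mu> where k: "k \<ge> 1" and \<mu>A: "\<mu> \<in> A" and \<mu>B: "(push_forward X T ^^ k) \<mu> \<in> B"
    unfolding hitting_times_def by blast
  have \<mu>: "\<mu> \<in> borel_prob_measures X" "prob_space \<mu>" using \<mu>A by (auto simp: A_def borel_prob_measures_def)
  interpret prob_space \<mu> by fact
  note Tk = measurable_funpow_borel_prob_measure[OF sys \<mu>(1), of k]
  note id = measurable_funpow_borel_prob_measure[OF sys \<mu>(1), of 0, simplified]
  have space: "space \<mu> = X"
    using \<mu>(1) sets_eq_imp_space_eq[of \<mu> "restrict_space borel X"]
    by (simp add: borel_prob_measures_def space_restrict_space)
  have hit: "k \<in> hitting_times T U W"
    if h: "continuous_on X h" "\<And>x. h x \<le> 1" "\<And>x. x \<in> X \<Longrightarrow> h x > 0 \<Longrightarrow> x \<in> W"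
      and large: "(\<integral>x. h x \<partial>(push_forward X T ^^ k) \<mu>) > 1 / 3" for h :: "'a \<Rightarrow> real" and W
  proof (rule ccontr)
    assume not: "k \<notin> hitting_times T U W"
    have int_h: "integrable \<mu> (\<lambda>x. h ((T ^^ k) x))"
      by (rule integrable_continuous_bounded_measurable[OF \<mu>(2) Tk X h(1)])
    have int_f: "integrable \<mu> (\<lambda>x. f x)"
      using integrable_continuous_bounded_measurable[OF \<mu>(2) id X f(1)] by simp
    \<comment> \<open>Otherwise both terms, being at most 1, are positive, and \<open>x\<close> goes from \<open>U\<close> to \<open>W\<close>.\<close>
    have "f x + h ((T ^^ k) x) \<le> 1" if x: "x \<in> X" for x
    proof (rule ccontr)
      assume "\<not> ?thesis"
      then have "f x > 0" "h ((T ^^ k) x) > 0"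
        using f(5)[of x] h(2)[of "(T ^^ k) x"] by linarith+
      moreover have "(T ^^ k) x \<in> X"
        using funpow_image_eq[of T X k] sys x unfolding dynamical_system_def by blast
      ultimately have "x \<in> U" "(T ^^ k) x \<in> W"
        using f(6) h(3) x by blast+
      then show False
        using not k unfolding hitting_times_def by blast
    qed
    then have "(\<integral>x. f x + h ((T ^^ k) x) \<partial>\<mu>) \<le> (\<integral>x. 1 \<partial>\<mu>)"
      using int_f int_h by (intro integral_mono) (auto simp: space)
    moreover have "(\<integral>x. f x + h ((T ^^ k) x) \<partial>\<mu>) = (\<integral>x. f x \<partial>\<mu>) + (\<integral>x. h ((T ^^ k) x) \<partial>\<mu>)"
      using int_f int_h by simp
    moreover have "(\<integral>x. h ((T ^^ k) x) \<partial>\<mu>) = (\<integral>x. h x \<partial>(push_forward X T ^^ k) \<mu>)"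
      unfolding push_forward_funpow[OF sys \<mu>(1)]
      by (rule integral_distr[OF Tk borel_measurable_continuous_on_restrict[OF h(1)], symmetric])
    ultimately show False
      using large \<mu>A by (simp add: A_def prob_space)
  qed
  have "k \<in> hitting_times T U V" "k \<in> hitting_times T U V'"
    using hit[OF g(1,5,6)] hit[OF g'(1,5,6)] \<mu>B by (auto simp: B_def)
  then show ?thesis by blast
qed

theorem propositionA2:
  fixes X :: "'a::metric_space set" and T :: "'a \<Rightarrow> 'a"
  assumes "dynamical_system X T"
  shows "(weakly_mixing (top_of_set X) T \<longleftrightarrow>
            weakly_mixing (weak_star_topology X) (push_forward X T)) \<and>
         (weakly_mixing (weak_star_topology X) (push_forward X T) \<longleftrightarrow>
            topologically_transitive (weak_star_topology X) (push_forward X T))"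
proof -
  have "weakly_mixing (top_of_set X) T"
    if "topologically_transitive (weak_star_topology X) (push_forward X T)"
    using weakly_mixing_if_common_source[OF dynamical_system_continuous_map[OF assms]]
      transitive_measures_common_source[OF assms that] assms
    by (simp add: dynamical_system_def)
  then show ?thesis
    using weakly_mixing_imp_weakly_mixing_measures[OF assms]
      weakly_mixing_imp_topologically_transitive by blast
qed

end
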